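(* Let $n$ be a positive integer. The quadratic unitary Cayley graph $G_n$ admits pretty good state transfer if and only if $n\in\{2,4,8\}$.
   Context: The quadratic unitary Cayley graph $G_n$ is the simple undirected graph with vertex set $\mathbb{Z}_n$ in which two distinct vertices $a,b$ are adjacent if and only if $a-b\equiv u^2$ or $a-b\equiv -u^2 \pmod n$ for some integer $u$ with $1\le u\le n-1$ and $\gcd(u,n)=1$. For a finite simple undirected graph $\Gamma$ with adjacency matrix $A$, the transition matrix is $H(t)=\exp(-\mathbf{i}tA)$, $t\in\mathbb{R}$, where $\mathbf{i}=\sqrt{-1}$. For a vertex $a$, $\mathbf{e}_a$ is the standard basis column vector indexed by the vertices with entry $1$ at $a$ and $0$ elsewhere. $\Gamma$ admits pretty good state transfer (PGST) from a vertex $a$ to another vertex $b\neq a$ if there is a real sequence $\{t_k\}$ such that $\lim_{k\to\infty}H(t_k)\mathbf{e}_a=\beta\mathbf{e}_b$ for some complex number $\beta$ with $|\beta|=1$. $\Gamma$ admits PGST if it does so from some vertex $a$ to some other vertex $b$. *)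

theory Defs
  imports
    "HOL-Number_Theory.Cong"
    "Jordan_Normal_Form.Jordan_Normal_Form"
begin

text \<open>
  A finite simple graph on the vertex set \<open>{0..<n}\<close> is given by \<open>n\<close> and a
  symmetric irreflexive adjacency relation.  The set of residues modulo \<open>n\<close> is represented
  by \<open>{0..<n}\<close>.
\<close>

definition simple_graph :: "nat \<Rightarrow> (nat \<Rightarrow> nat \<Rightarrow> bool) \<Rightarrow> bool" where
  "simple_graph n E \<longleftrightarrow>
     (\<forall>a<n. \<not> E a a) \<and> (\<forall>a<n. \<forall>b<n. E a b \<longrightarrow> E b a)"

text \<open>Adjacency in the quadratic unitary Cayley graph on the residues modulo \<open>n\<close>.\<close>

definition quc_adj :: "nat \<Rightarrow> nat \<Rightarrow> nat \<Rightarrow> bool" where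
  "quc_adj n a b \<longleftrightarrow> a \<noteq> b \<and>
     (\<exists>u::int. 1 \<le> u \<and> u \<le> int n - 1 \<and> gcd u (int n) = 1 \<and>
        ([int a - int b = u\<^sup>2] (mod (int n)) \<or> [int a - int b = - (u\<^sup>2)] (mod (int n))))"

lemma quc_adj_sym: "quc_adj n a b \<Longrightarrow> quc_adj n b a"
  unfolding quc_adj_def
  by (metis cong_minus_minus_iff minus_diff_eq minus_minus)

lemma simple_graph_quc: "simple_graph n (quc_adj n)"
  using quc_adj_sym by (auto simp: simple_graph_def quc_adj_def)

definition adjacency_mat :: "nat \<Rightarrow> (nat \<Rightarrow> nat \<Rightarrow> bool) \<Rightarrow> complex mat" where
  "adjacency_mat n E = mat n n (\<lambda>(a, b). if E a b then 1 else 0)"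

text \<open>
  The exponential of a square matrix is the sum of the usual power series, taken entrywise;
  \<open>mat_exp_summable\<close> shows that the series converges, so that \<open>suminf\<close> is not a junk value.
\<close>

definition mat_exp :: "complex mat \<Rightarrow> complex mat" where
  "mat_exp A = mat (dim_row A) (dim_row A) (\<lambda>(i, j). \<Sum>k. (A ^\<^sub>m k) $$ (i, j) / fact k)"

lemma mat_exp_summable:
  assumes A: "A \<in> carrier_mat n n" and ij: "i < n" "j < n"
  shows "summable (\<lambda>k. (A ^\<^sub>m k) $$ (i, j) / (fact k :: complex))"
proof -
  obtain b where b: "norm_bound A b" using norm_bound_max by blast
  have bk: "norm_bound (A ^\<^sub>m k) ((b * of_nat n) ^ k)" for k
  proof (induction k)
    case 0
    then show ?case using A by (auto simp: norm_bound_def)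
  next
    case (Suc k)
    show ?case
      using norm_bound_mult[OF pow_carrier_mat[OF A] A Suc b] by (simp add: mult_ac)
  qed
  show ?thesis
  proof (rule summable_comparison_test')
    show "summable (\<lambda>k. inverse (fact k) * (b * of_nat n) ^ k :: real)"
      by (rule summable_exp)
    show "norm ((A ^\<^sub>m k) $$ (i, j) / (fact k :: complex))
            \<le> inverse (fact k) * (b * of_nat n) ^ k" if "k \<ge> 0" for k
    proof -
      have "cmod ((A ^\<^sub>m k) $$ (i, j)) \<le> (b * of_nat n) ^ k"
        using bk[of k] A ij by (simp add: norm_bound_def split: if_splits)
      then show ?thesis by (simp add: norm_divide field_simps)
    qed
  qed
qed

definition transition_mat :: "nat \<Rightarrow> (nat \<Rightarrow> nat \<Rightarrow> bool) \<Rightarrow> real \<Rightarrow> complex mat" where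
  "transition_mat n E t = mat_exp ((- (\<i> * complex_of_real t)) \<cdot>\<^sub>m adjacency_mat n E)"

text \<open>
  The type \<open>complex vec\<close> carries no topology in the library; convergence of vectors of the
  same finite dimension is coordinatewise convergence.
\<close>

definition vec_tendsto :: "nat \<Rightarrow> (nat \<Rightarrow> complex vec) \<Rightarrow> complex vec \<Rightarrow> bool" where
  "vec_tendsto n X v \<longleftrightarrow> (\<forall>i<n. (\<lambda>k. X k $ i) \<longlonglongrightarrow> v $ i)"

definition pgst_between :: "nat \<Rightarrow> (nat \<Rightarrow> nat \<Rightarrow> bool) \<Rightarrow> nat \<Rightarrow> nat \<Rightarrow> bool" where
  "pgst_between n E a b \<longleftrightarrow>
     (\<exists>t :: nat \<Rightarrow> real. \<exists>\<beta> :: complex. cmod \<beta> = 1 \<and>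
        vec_tendsto n (\<lambda>k. transition_mat n E (t k) *\<^sub>v unit_vec n a) (\<beta> \<cdot>\<^sub>v unit_vec n b))"

definition admits_pgst :: "nat \<Rightarrow> (nat \<Rightarrow> nat \<Rightarrow> bool) \<Rightarrow> bool" where
  "admits_pgst n E \<longleftrightarrow> (\<exists>a<n. \<exists>b<n. b \<noteq> a \<and> pgst_between n E a b)"

end

theory Submission
  imports Defs
begin

text \<open>
  The characters \<open>chi n (j * v)\<close> diagonalise a circulant graph with eigenvalues \<open>lam j\<close>, the character
  sums over the connection set, so state transfer from \<open>a\<close> to \<open>b\<close> at times \<open>t k\<close> means that
  \<open>exp (- i t k lam j)\<close> tends to \<open>\<beta> chi n (j (b - a))\<close> for all \<open>j\<close>.  If the connection set is symmetric,
  these limits are \<open>\<beta> (- 1)^j\<close>, and every relation \<open>lam j\<^sub>1 + \<dots> + lam j\<^sub>p = 0\<close> forces the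
  corresponding limits to have product \<open>1\<close>.  Let \<open>p\<close> be an odd prime divisor of \<open>n\<close>.  The connection
  set consists of units, so the eigenvalues with indices in a coset of the multiples of \<open>n / p\<close> add
  up to \<open>0\<close>; the cosets of \<open>0\<close> and \<open>1\<close> give \<open>\<beta>^p = 1\<close> and \<open>(- \<beta>)^p = 1\<close>, a contradiction.  If \<open>16\<close>
  divides \<open>n\<close>, then \<open>lam 1 = 0\<close>, because the connection set is invariant under translation by \<open>n / 2\<close>,
  and \<open>lam (n / 4) = 0\<close>, because it is symmetric with odd elements; this gives \<open>\<beta> = - 1\<close> and \<open>\<beta> = 1\<close>.
\<close>

section \<open>Characters of the residues modulo n\<close>

definition chi :: "nat \<Rightarrow> int \<Rightarrow> complex" where
  "chi n x = cis (2 * pi * real_of_int x / real n)"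

lemma chi_0 [simp]: "chi n 0 = 1"
  by (simp add: chi_def)

lemma chi_add: "chi n (x + y) = chi n x * chi n y"
  by (simp add: chi_def cis_mult add_divide_distrib distrib_left)

lemma chi_mult_of_nat: "chi n (int k * x) = chi n x ^ k"
  by (induction k) (simp_all add: distrib_right chi_add)

lemma chi_nonzero [simp]: "chi n x \<noteq> 0"
  by (simp add: chi_def)

lemma chi_minus: "chi n (- x) = inverse (chi n x)"
  by (simp add: chi_def)

lemma chi_self_mult [simp]: "chi n (int n * x) = 1"
  by (cases "n = 0") (simp_all add: chi_def cis_multiple_2pi flip: mult.assoc)

lemma chi_mod [simp]: "chi n (x mod int n) = chi n x"
proof -
  have "chi n x = chi n (int n * (x div int n) + x mod int n)"
    by simp
  then show ?thesis
    by (simp only: chi_add chi_self_mult mult_1)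
qed

lemma chi_cong: "[x = y] (mod int n) \<Longrightarrow> chi n x = chi n y"
  by (metis chi_mod cong_def)

lemma chi_eq_1_iff:
  assumes "n > 0"
  shows "chi n x = 1 \<longleftrightarrow> int n dvd x"
proof
  assume "chi n x = 1"
  then have "cos (2 * pi * real_of_int x / real n) = 1"
    by (simp add: chi_def complex_eq_iff)
  then obtain k :: int where "2 * pi * real_of_int x / real n = of_int k * 2 * pi"
    by (metis cos_one_2pi_int)
  then have "real_of_int x = real_of_int (k * int n)"
    using assms by (simp add: field_simps)
  then show "int n dvd x"
    by (metis dvd_triv_right of_int_eq_iff)
qed auto

lemma chi_scale:
  assumes "q > 0"
  shows "chi (q * d) (int q * x) = chi d x"
  using assms by (simp add: chi_def mult_ac)

lemma sum_chi:
  assumes "n > 0"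
  shows "(\<Sum>i<n. chi n (int i * x)) = (if int n dvd x then of_nat n else 0)"
proof (cases "int n dvd x")
  case True
  then have "chi n x = 1"
    using assms by (simp add: chi_eq_1_iff)
  then show ?thesis
    using True by (simp add: chi_mult_of_nat)
next
  case False
  then have "chi n x \<noteq> 1"
    using assms by (simp add: chi_eq_1_iff)
  moreover have "chi n x ^ n = 1"
    by (metis chi_mult_of_nat chi_self_mult)
  ultimately show ?thesis
    using False by (simp add: chi_mult_of_nat geometric_sum)
qed

text \<open>After the sums are swapped, orthogonality (\<open>sum_chi\<close>) isolates the term
  \<open>v = b\<close>. This turns limits of character transforms back into limits of vector
  entries.\<close>

lemma fourier_inversion:
  fixes x :: "nat \<Rightarrow> complex"
  assumes "b < n"
  shows "x b = (\<Sum>j<n. chi n (- (int j * int b)) * (\<Sum>v<n. chi n (int j * int v) * x v)) / of_nat n"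
proof -
  have n: "n > 0"
    using assms by simp
  have eq: "int n dvd int v - int b \<longleftrightarrow> v = b" if "v < n" for v
    using that assms by (metis cong_iff_dvd_diff cong_int_iff cong_less_modulus_unique_nat dvd_0_right diff_self)
  have "(\<Sum>j<n. chi n (- (int j * int b)) * (\<Sum>v<n. chi n (int j * int v) * x v))
      = (\<Sum>j<n. \<Sum>v<n. chi n (int j * (int v - int b)) * x v)"
    by (simp add: sum_distrib_left right_diff_distrib flip: chi_add mult.assoc)
  also have "\<dots> = (\<Sum>v<n. (\<Sum>j<n. chi n (int j * (int v - int b))) * x v)"
    by (subst sum.swap) (simp add: sum_distrib_right)
  also have "\<dots> = (\<Sum>v<n. if v = b then of_nat n * x v else 0)"
    using eq by (intro sum.cong) (auto simp: sum_chi[OF n])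
  also have "\<dots> = of_nat n * x b"
    using assms by simp
  finally show ?thesis
    using n by simp
qed

section \<open>Circulant graphs\<close>

text \<open>Least residues represent the differences, so that each class contributes exactly one
  term to a character sum over \<open>S\<close>.\<close>

locale circulant =
  fixes n :: nat and E :: "nat \<Rightarrow> nat \<Rightarrow> bool" and S :: "int set"
  assumes n_pos: "n > 0"
    and S_sub: "S \<subseteq> {0..<int n}"
    and E_iff: "a < n \<Longrightarrow> b < n \<Longrightarrow> E a b \<longleftrightarrow> (int a - int b) mod int n \<in> S"
begin

section \<open>Characters as eigenvectors of the adjacency and transition matrices\<close>

definition lam :: "int \<Rightarrow> complex" where
  "lam j = (\<Sum>s\<in>S. chi n (j * s))"

abbreviation A :: "complex mat" where
  "A \<equiv> adjacency_mat n E"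

lemma finite_S [simp]: "finite S"
  using S_sub finite_subset by blast

lemma A_carrier: "A \<in> carrier_mat n n"
  by (simp add: adjacency_mat_def)

text \<open>The character is a left eigenvector: \<open>v\<close> goes to \<open>v - w\<close>
  modulo \<open>n\<close>, which maps the neighbours of \<open>w\<close> bijectively onto
  \<open>S\<close>, and the factor \<open>chi n (j * w)\<close> splits off.\<close>

lemma chi_A:
  assumes "w < n"
  shows "(\<Sum>v<n. chi n (j * int v) * A $$ (v, w)) = lam j * chi n (j * int w)"
proof -
  have "(\<Sum>v<n. chi n (j * int v) * A $$ (v, w)) = (\<Sum>v | v < n \<and> E v w. chi n (j * int v))"
    using assms by (simp add: adjacency_mat_def sum.If_cases if_distrib[of "\<lambda>x. _ * x"] cong: if_cong)
      (simp add: Int_def)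
  also have "\<dots> = (\<Sum>s\<in>S. chi n (j * (s + int w)))"
  proof (rule sum.reindex_bij_witness[where j = "\<lambda>v. (int v - int w) mod int n"
        and i = "\<lambda>s. nat ((s + int w) mod int n)"])
    fix v assume v: "v \<in> {v. v < n \<and> E v w}"
    then show "nat (((int v - int w) mod int n + int w) mod int n) = v"
      by (simp add: mod_simps)
    show "(int v - int w) mod int n \<in> S"
      using v E_iff assms by blast
    have "[j * ((int v - int w) mod int n + int w) = j * int v] (mod int n)"
      by (rule cong_mult) (simp_all add: cong_def mod_simps)
    then show "chi n (j * ((int v - int w) mod int n + int w)) = chi n (j * int v)"
      by (rule chi_cong)
  next
    fix s assume s: "s \<in> S"
    then have "0 \<le> s" "s < int n"
      using S_sub by auto
    then show *: "(int (nat ((s + int w) mod int n)) - int w) mod int n = s"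
      using n_pos by (simp add: mod_simps)
    have "nat ((s + int w) mod int n) < n"
      using n_pos by (simp add: nat_less_iff)
    then show "nat ((s + int w) mod int n) \<in> {v. v < n \<and> E v w}"
      using * s E_iff assms by simp
  qed
  also have "\<dots> = lam j * chi n (j * int w)"
    by (simp add: lam_def sum_distrib_right distrib_left chi_add)
  finally show ?thesis .
qed

lemma chi_A_pow:
  assumes "w < n"
  shows "(\<Sum>v<n. chi n (j * int v) * (A ^\<^sub>m k) $$ (v, w)) = lam j ^ k * chi n (j * int w)"
  using assms
proof (induction k arbitrary: w)
  case 0
  have "(\<Sum>v<n. chi n (j * int v) * (A ^\<^sub>m 0) $$ (v, w))
      = (\<Sum>v<n. if v = w then chi n (j * int v) else 0)"
    using 0 A_carrier by (intro sum.cong) auto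
  then show ?case
    using 0 by simp
next
  case (Suc k)
  note Ak = pow_carrier_mat[OF A_carrier, of k]
  have "(\<Sum>v<n. chi n (j * int v) * (A ^\<^sub>m Suc k) $$ (v, w))
      = (\<Sum>v<n. chi n (j * int v) * (\<Sum>u<n. (A ^\<^sub>m k) $$ (v, u) * A $$ (u, w)))"
    using Suc.prems A_carrier Ak
    by (intro sum.cong) (auto simp: scalar_prod_def atLeast0LessThan intro!: sum.cong)
  also have "\<dots> = (\<Sum>u<n. (\<Sum>v<n. chi n (j * int v) * (A ^\<^sub>m k) $$ (v, u)) * A $$ (u, w))"
    by (simp add: sum_distrib_left sum_distrib_right mult.assoc) (rule sum.swap)
  also have "\<dots> = lam j ^ k * (\<Sum>u<n. chi n (j * int u) * A $$ (u, w))"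
    using Suc.IH by (simp add: sum_distrib_left mult.assoc)
  also have "\<dots> = lam j ^ Suc k * chi n (j * int w)"
    using chi_A[OF Suc.prems] by simp
  finally show ?case .
qed

lemma smult_pow_mat: "((c \<cdot>\<^sub>m A) ^\<^sub>m k) = c ^ k \<cdot>\<^sub>m (A ^\<^sub>m k)"
proof (induction k)
  case 0
  show ?case
    using A_carrier by auto
next
  case (Suc k)
  note Ak = pow_carrier_mat[OF A_carrier, of k]
  have "(c \<cdot>\<^sub>m A) ^\<^sub>m Suc k = c ^ k \<cdot>\<^sub>m (A ^\<^sub>m k * (c \<cdot>\<^sub>m A))"
    using Suc mult_smult_assoc_mat[OF Ak, of "c \<cdot>\<^sub>m A" n "c ^ k"] A_carrier by simp
  also have "\<dots> = c ^ Suc k \<cdot>\<^sub>m A ^\<^sub>m Suc k"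
    using mult_smult_distrib[OF Ak A_carrier] by (auto simp: mult_ac)
  finally show ?case .
qed

lemma transition_mat_unit_vec:
  assumes "a < n" "v < n"
  shows "(transition_mat n E t *\<^sub>v unit_vec n a) $ v = transition_mat n E t $$ (v, a)"
  using assms A_carrier by (simp add: transition_mat_def mat_exp_def)

text \<open>A left eigenvector of \<open>A\<close> is one of every power, hence of the exponential
  series; the finite sum over \<open>v\<close> may be taken termwise in the series.\<close>

lemma chi_transition_mat:
  assumes "w < n"
  shows "(\<Sum>v<n. chi n (j * int v) * transition_mat n E t $$ (v, w))
    = exp (- (\<i> * of_real t) * lam j) * chi n (j * int w)"
proof -
  define c where "c = - (\<i> * complex_of_real t)"
  have "(\<lambda>k. (\<Sum>v<n. chi n (j * int v) * (((c \<cdot>\<^sub>m A) ^\<^sub>m k) $$ (v, w) / fact k))) sums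
      (\<Sum>v<n. chi n (j * int v) * transition_mat n E t $$ (v, w))"
  proof (intro sums_sum sums_mult)
    fix v assume "v \<in> {..<n}"
    then show "(\<lambda>k. ((c \<cdot>\<^sub>m A) ^\<^sub>m k) $$ (v, w) / fact k) sums transition_mat n E t $$ (v, w)"
      using assms A_carrier mat_exp_summable[of "c \<cdot>\<^sub>m A" n v w]
      by (simp add: transition_mat_def mat_exp_def c_def summable_sums)
  qed
  moreover have "(\<Sum>v<n. chi n (j * int v) * (((c \<cdot>\<^sub>m A) ^\<^sub>m k) $$ (v, w) / fact k))
      = (c * lam j) ^ k /\<^sub>R fact k * chi n (j * int w)" for k
  proof -
    have "(\<Sum>v<n. chi n (j * int v) * (((c \<cdot>\<^sub>m A) ^\<^sub>m k) $$ (v, w) / fact k))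
        = (\<Sum>v<n. chi n (j * int v) * (A ^\<^sub>m k) $$ (v, w)) * (c ^ k / fact k)"
      using assms A_carrier pow_carrier_mat[OF A_carrier, of k]
      by (simp add: smult_pow_mat sum_distrib_left sum_divide_distrib mult_ac)
    then show ?thesis
      using chi_A_pow[OF assms] by (simp add: power_mult_distrib scaleR_conv_of_real field_simps)
  qed
  moreover have "(\<lambda>k. (c * lam j) ^ k /\<^sub>R fact k * chi n (j * int w)) sums
      (exp (c * lam j) * chi n (j * int w))"
    by (intro sums_mult2 exp_converges)
  ultimately show ?thesis
    unfolding c_def using sums_unique2 by simp
qed

text \<open>The character transform is a linear bijection in finite dimension, so a column converges
  coordinatewise if and only if all its transforms converge. The limit
  \<open>\<beta> \<cdot>\<^sub>v unit_vec n b\<close> has the transforms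
  \<open>\<beta> * chi n (j * b)\<close>; the factor \<open>chi n (j * a)\<close> is moved
  across.\<close>

lemma pgst_between_iff:
  assumes "a < n" "b < n"
  shows "pgst_between n E a b \<longleftrightarrow>
    (\<exists>(t :: nat \<Rightarrow> real) \<beta>. cmod \<beta> = 1 \<and>
      (\<forall>j. (\<lambda>k. exp (- (\<i> * of_real (t k)) * lam j)) \<longlonglongrightarrow> \<beta> * chi n (j * (int b - int a))))"
proof -
  have "vec_tendsto n (\<lambda>k. transition_mat n E (t k) *\<^sub>v unit_vec n a) (\<beta> \<cdot>\<^sub>v unit_vec n b) \<longleftrightarrow>
    (\<forall>j. (\<lambda>k. exp (- (\<i> * of_real (t k)) * lam j)) \<longlonglongrightarrow> \<beta> * chi n (j * (int b - int a)))"
    (is "?L \<longleftrightarrow> ?R") for t :: "nat \<Rightarrow> real" and \<beta>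
  proof
    assume L: ?L
    show ?R
    proof
      fix j
      have "(\<lambda>k. \<Sum>v<n. chi n (j * int v) * transition_mat n E (t k) $$ (v, a)) \<longlonglongrightarrow>
          (\<Sum>v<n. chi n (j * int v) * (\<beta> * (if v = b then 1 else 0)))"
        using L assms unfolding vec_tendsto_def
        by (intro tendsto_sum tendsto_mult tendsto_const) (simp add: transition_mat_unit_vec)
      also have "(\<Sum>v<n. chi n (j * int v) * (\<beta> * (if v = b then 1 else 0)))
          = (\<Sum>v<n. if v = b then \<beta> * chi n (j * int v) else 0)"
        by (intro sum.cong) auto
      also have "\<dots> = \<beta> * chi n (j * int b)"
        using assms by simp
      finally have "(\<lambda>k. exp (- (\<i> * of_real (t k)) * lam j) * chi n (j * int a)) \<longlonglongrightarrow>
          \<beta> * chi n (j * int b)"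
        by (simp only: chi_transition_mat[OF assms(1)])
      then have "(\<lambda>k. exp (- (\<i> * of_real (t k)) * lam j) * chi n (j * int a) * chi n (- (j * int a)))
          \<longlonglongrightarrow> \<beta> * chi n (j * int b) * chi n (- (j * int a))"
        by (rule tendsto_mult[OF _ tendsto_const])
      then show "(\<lambda>k. exp (- (\<i> * of_real (t k)) * lam j)) \<longlonglongrightarrow> \<beta> * chi n (j * (int b - int a))"
        by (simp add: mult.assoc right_diff_distrib flip: chi_add)
    qed
  next
    assume R: ?R
    show ?L
      unfolding vec_tendsto_def
    proof (intro allI impI)
      fix v assume v: "v < n"
      \<comment> \<open>The inverse transform at \<open>v\<close>, with the factor
        \<open>chi n (j * a)\<close> restored.\<close>
      let ?f = "\<lambda>x. (\<Sum>j<n. chi n (- (int j * int v)) * (x j * chi n (int j * int a))) / of_nat n"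
      have "(\<lambda>k. ?f (\<lambda>j. exp (- (\<i> * of_real (t k)) * lam (int j)))) \<longlonglongrightarrow>
          ?f (\<lambda>j. \<beta> * chi n (int j * (int b - int a)))"
        using n_pos by (intro tendsto_divide tendsto_sum tendsto_mult tendsto_const R[rule_format]) simp_all
      moreover have "?f (\<lambda>j. exp (- (\<i> * of_real (t k)) * lam (int j)))
          = (transition_mat n E (t k) *\<^sub>v unit_vec n a) $ v" for k
        unfolding transition_mat_unit_vec[OF assms(1) v]
        by (subst fourier_inversion[OF v]) (simp add: chi_transition_mat[OF assms(1)])
      moreover have "?f (\<lambda>j. \<beta> * chi n (int j * (int b - int a))) = (\<beta> \<cdot>\<^sub>v unit_vec n b) $ v"
      proof -
        have "(\<beta> \<cdot>\<^sub>v unit_vec n b) $ v = \<beta> * (if v = b then 1 else 0)"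
          using v assms by simp
        also have "\<dots> = (\<Sum>j<n. chi n (- (int j * int v)) *
            (\<Sum>w<n. chi n (int j * int w) * (\<beta> * (if w = b then 1 else 0)))) / of_nat n"
          by (rule fourier_inversion[OF v])
        also have "\<dots> = (\<Sum>j<n. chi n (- (int j * int v)) *
            (\<Sum>w<n. if w = b then \<beta> * chi n (int j * int w) else 0)) / of_nat n"
          by (intro arg_cong2[where f = "(/)"] sum.cong arg_cong2[where f = "(*)"]) auto
        also have "\<dots> = (\<Sum>j<n. chi n (- (int j * int v)) * (\<beta> * chi n (int j * int b))) / of_nat n"
          using assms by simp
        also have "\<dots> = ?f (\<lambda>j. \<beta> * chi n (int j * (int b - int a)))"
          by (simp add: right_diff_distrib mult.assoc flip: chi_add)
        finally show ?thesis ..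
      qed
      ultimately show "(\<lambda>k. (transition_mat n E (t k) *\<^sub>v unit_vec n a) $ v) \<longlonglongrightarrow> (\<beta> \<cdot>\<^sub>v unit_vec n b) $ v"
        by simp
    qed
  qed
  then show ?thesis
    by (simp add: pgst_between_def)
qed

section \<open>Relations among the eigenvalues and their effect on the limits\<close>

lemma lam_cong:
  assumes "[i = j] (mod int n)"
  shows "lam i = lam j"
  unfolding lam_def using assms by (intro sum.cong chi_cong cong_mult) simp_all

text \<open>Translation by \<open>c\<close> is injective modulo \<open>n\<close>, so it permutes the
  finite set \<open>S\<close>, and it multiplies each term of \<open>lam j\<close> by
  \<open>chi n (j * c)\<close>. If that factor is not 1, the eigenvalue vanishes.\<close>

lemma chi_mult_lam_shift:
  assumes "\<And>s. s \<in> S \<Longrightarrow> (s + c) mod int n \<in> S"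
  shows "chi n (j * c) * lam j = lam j"
proof -
  let ?f = "\<lambda>s. (s + c) mod int n"
  have "inj_on ?f S"
  proof (rule inj_onI)
    fix x y assume xy: "x \<in> S" "y \<in> S" "?f x = ?f y"
    then have "[x = y] (mod int n)"
      by (metis cong_add_rcancel cong_def)
    then show "x = y"
      using xy S_sub by (metis atLeastLessThan_iff cong_less_imp_eq_int subsetD)
  qed
  moreover from this have "?f ` S = S"
    using assms by (intro endo_inj_surj) auto
  ultimately have "bij_betw ?f S S"
    by (simp add: bij_betw_def)
  then have "lam j = (\<Sum>s\<in>S. chi n (j * ?f s))"
    unfolding lam_def by (rule sum.reindex_bij_betw[symmetric])
  also have "\<dots> = (\<Sum>s\<in>S. chi n (j * (s + c)))"
    by (intro sum.cong chi_cong) (simp_all add: cong_def mod_simps)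
  also have "\<dots> = chi n (j * c) * lam j"
    by (simp add: lam_def sum_distrib_left distrib_left chi_add mult.commute)
  finally show ?thesis ..
qed

lemma lam_uminus:
  assumes "\<And>s. s \<in> S \<Longrightarrow> (- s) mod int n \<in> S"
  shows "lam (- j) = lam j"
proof -
  have *: "(- ((- s) mod int n)) mod int n = s" if "s \<in> S" for s
    using that S_sub by (auto simp: mod_simps)
  show ?thesis
    unfolding lam_def
    using assms *
    by (intro sum.reindex_bij_witness[where i = "\<lambda>s. (- s) mod int n" and j = "\<lambda>s. (- s) mod int n"])
      (auto intro!: chi_cong simp: cong_def mod_simps)
qed

text \<open>With the sums swapped, each \<open>s\<close> contributes a multiple of the sum of
  \<open>chi d (i * s)\<close> over \<open>i < d\<close>, which is 0 because \<open>d\<close> does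
  not divide \<open>s\<close>.\<close>

lemma sum_lam_eq_0:
  assumes "n = q * d" and "\<And>s. s \<in> S \<Longrightarrow> \<not> int d dvd s"
  shows "(\<Sum>i<d. lam (j + int i * int q)) = 0"
proof -
  have qd: "q > 0" "d > 0"
    using n_pos assms(1) by auto
  have "(\<Sum>i<d. lam (j + int i * int q)) = (\<Sum>s\<in>S. chi n (j * s) * (\<Sum>i<d. chi n (int q * (int i * s))))"
    unfolding lam_def by (subst sum.swap) (simp add: sum_distrib_left algebra_simps flip: chi_add)
  also have "\<dots> = (\<Sum>s\<in>S. 0)"
    using assms qd by (intro sum.cong) (auto simp: chi_scale sum_chi)
  finally show ?thesis
    by simp
qed

text \<open>The exponential turns the vanishing sum into a product that equals 1 at every time, so
  the product of the limits is 1 as well.\<close>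

lemma prod_limit_eq_1:
  assumes "\<And>i. (\<lambda>k. exp (- (\<i> * of_real (t k)) * lam (f i))) \<longlonglongrightarrow> L i"
    and "(\<Sum>i<d. lam (f i)) = 0"
  shows "(\<Prod>i<(d::nat). L i) = 1"
proof -
  have "(\<lambda>k. \<Prod>i<d. exp (- (\<i> * of_real (t k)) * lam (f i))) \<longlonglongrightarrow> (\<Prod>i<d. L i)"
    by (intro tendsto_prod assms(1))
  moreover have "(\<Prod>i<d. exp (- (\<i> * of_real (t k)) * lam (f i))) = 1" for k
    using assms(2) by (simp flip: exp_sum sum_distrib_left add: sum_negf)
  ultimately show ?thesis
    by (simp add: LIMSEQ_const_iff)
qed

text \<open>
  Since \<open>lam j = lam (- j)\<close>, the translation \<open>c = b - a\<close> satisfies \<open>chi n c = chi n (- c)\<close>,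
  so that \<open>c\<close> is the involution \<open>n / 2\<close> and its character values are signs.
\<close>

lemma pgst_between_signs:
  assumes "\<And>s. s \<in> S \<Longrightarrow> (- s) mod int n \<in> S"
    and "a < n" "b < n" "a \<noteq> b" "pgst_between n E a b"
  obtains t :: "nat \<Rightarrow> real" and \<beta> where "even n" and
    "\<And>j. (\<lambda>k. exp (- (\<i> * of_real (t k)) * lam (int j))) \<longlonglongrightarrow> \<beta> * (- 1) ^ j"
proof -
  define c where "c = int b - int a"
  from assms obtain t :: "nat \<Rightarrow> real" and \<beta> where \<beta>: "cmod \<beta> = 1"
    and lim: "\<And>j. (\<lambda>k. exp (- (\<i> * of_real (t k)) * lam j)) \<longlonglongrightarrow> \<beta> * chi n (j * c)"
    unfolding pgst_between_iff[OF assms(2,3)] c_def by blast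
  have "\<beta> * chi n (1 * c) = \<beta> * chi n (- 1 * c)"
    using LIMSEQ_unique[OF lim[of 1]] lim[of "- 1"] lam_uminus[OF assms(1), of 1] by simp
  then have sq: "chi n c * chi n c = 1"
    using \<beta> by (auto simp: chi_minus field_simps)
  have "\<not> int n dvd c"
    using assms(2-4) by (metis c_def cong_iff_dvd_diff cong_int_iff cong_less_modulus_unique_nat)
  then have "chi n c \<noteq> 1"
    using n_pos by (simp add: chi_eq_1_iff)
  with sq have chi_c: "chi n c = - 1"
    by (metis square_eq_1_iff)
  have "int n dvd 2 * c"
    using sq n_pos by (simp flip: chi_add chi_eq_1_iff)
  \<comment> \<open>An odd \<open>n\<close> would be coprime to 2 and hence divide \<open>c\<close>
    itself.\<close>
  then have "even n"
    using \<open>\<not> int n dvd c\<close>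
    by (metis coprime_dvd_mult_right_iff coprime_right_2_iff_odd even_of_nat)
  moreover have "(\<lambda>k. exp (- (\<i> * of_real (t k)) * lam (int j))) \<longlonglongrightarrow> \<beta> * (- 1) ^ j" for j
    using lim[of "int j"] chi_c by (simp add: chi_mult_of_nat)
  ultimately show ?thesis
    using that by blast
qed

text \<open>Both the eigenvalues and the prescribed limits are periodic in \<open>j\<close> modulo
  \<open>n\<close>, so one full period of indices suffices.\<close>

lemma pgst_betweenI:
  assumes "a < n" "b < n" "cmod \<beta> = 1"
    and "\<And>j. j < n \<Longrightarrow>
      (\<lambda>k. exp (- (\<i> * of_real (t k)) * lam (int j))) \<longlonglongrightarrow> \<beta> * chi n (int j * (int b - int a))"
  shows "pgst_between n E a b"
proof -
  have "(\<lambda>k. exp (- (\<i> * of_real (t k)) * lam j)) \<longlonglongrightarrow> \<beta> * chi n (j * (int b - int a))" for j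
  proof -
    define i where "i = nat (j mod int n)"
    have i: "i < n" "[int i = j] (mod int n)"
      using n_pos by (simp_all add: i_def nat_less_iff cong_def)
    then have "lam (int i) = lam j" "chi n (int i * (int b - int a)) = chi n (j * (int b - int a))"
      by (auto intro!: lam_cong chi_cong cong_mult)
    then show ?thesis
      using assms(4)[OF i(1)] by simp
  qed
  then show ?thesis
    using assms by (auto simp: pgst_between_iff)
qed

end

section \<open>Pretty good state transfer in the quadratic unitary Cayley graph\<close>

text \<open>The unit \<open>u\<close> is left unbounded, so that witnesses need no reduction modulo
  \<open>n\<close>. Excluding the residue 0 keeps the case \<open>n = 1\<close> free of
  loops.\<close>

definition quc_set :: "nat \<Rightarrow> int set" where
  "quc_set n = {s \<in> {1..<int n}. \<exists>u. coprime u (int n) \<and>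
     ([s = u\<^sup>2] (mod int n) \<or> [s = - (u\<^sup>2)] (mod int n))}"

lemma quc_adj_iff:
  assumes "a < n" "b < n"
  shows "quc_adj n a b \<longleftrightarrow> (int a - int b) mod int n \<in> quc_set n"
proof (cases "a = b")
  case True
  then show ?thesis
    by (simp add: quc_adj_def quc_set_def)
next
  case False
  with assms have n: "n > 1"
    by linarith
  let ?r = "(int a - int b) mod int n"
  have "\<not> [int a = int b] (mod int n)"
    using assms False by (metis cong_less_modulus_unique_nat cong_int_iff)
  then have "?r \<noteq> 0"
    by (metis cong_iff_dvd_diff mod_0_imp_dvd)
  moreover have "0 \<le> ?r" "?r < int n"
    using n by simp_all
  ultimately have r: "?r \<in> {1..<int n}"
    by simp
  define P where "P u \<longleftrightarrow> [int a - int b = u\<^sup>2] (mod int n) \<or> [int a - int b = - (u\<^sup>2)] (mod int n)" for u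
  have "\<exists>u. 1 \<le> u \<and> u \<le> int n - 1 \<and> gcd u (int n) = 1 \<and> P u"
    if u: "coprime u (int n)" "P u" for u
  proof (intro exI conjI)
    let ?u = "u mod int n"
    show "gcd ?u (int n) = 1"
      using u(1) n by (simp flip: coprime_iff_gcd_eq_1)
    then have "?u \<noteq> 0"
      using n by auto
    moreover have "0 \<le> ?u" "?u < int n"
      using n by simp_all
    ultimately show "1 \<le> ?u" "?u \<le> int n - 1"
      by linarith+
    have "[u\<^sup>2 = ?u\<^sup>2] (mod int n)"
      by (simp add: cong_def power_mod)
    with u(2) show "P ?u"
      unfolding P_def by (metis cong_minus_minus_iff cong_trans)
  qed
  then have "quc_adj n a b \<longleftrightarrow> (\<exists>u. coprime u (int n) \<and> P u)"
    using False unfolding quc_adj_def coprime_iff_gcd_eq_1 P_def[symmetric] by metis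
  also have "\<dots> \<longleftrightarrow> ?r \<in> quc_set n"
    using r by (simp add: quc_set_def P_def cong_def)
  finally show ?thesis .
qed

lemma circulant_quc:
  assumes "n > 0"
  shows "circulant n (quc_adj n) (quc_set n)"
  using assms by unfold_locales (auto simp: quc_set_def quc_adj_iff)

lemma coprime_quc_set:
  assumes "s \<in> quc_set n"
  shows "coprime s (int n)"
proof -
  from assms obtain u where "coprime u (int n)" "[u\<^sup>2 = s] (mod int n) \<or> [- (u\<^sup>2) = s] (mod int n)"
    by (auto simp: quc_set_def cong_sym_eq)
  then show ?thesis
    by (metis cong_imp_coprime coprime_minus_left_iff coprime_power_left_iff)
qed

lemma odd_if_coprime_even:
  assumes "coprime u (int n)" "even n"
  shows "odd u"
  using assms by (metis coprime_common_divisor even_of_nat odd_one)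

lemma uminus_quc_set:
  assumes "s \<in> quc_set n"
  shows "(- s) mod int n \<in> quc_set n"
proof -
  from assms obtain u where s: "0 < s" "s < int n" and u: "coprime u (int n)"
    and "[s = u\<^sup>2] (mod int n) \<or> [s = - (u\<^sup>2)] (mod int n)"
    by (auto simp: quc_set_def)
  then have "[- s = u\<^sup>2] (mod int n) \<or> [- s = - (u\<^sup>2)] (mod int n)"
    by (metis cong_minus_minus_iff minus_minus)
  moreover have "(- s) mod int n \<in> {1..<int n}"
    using s by (simp add: zmod_zminus1_eq_if)
  ultimately show ?thesis
    using u by (auto simp: quc_set_def cong_def)
qed

section \<open>Necessity: exclusion of odd prime divisors and of the divisor 16\<close>

lemma pgst_quc_signs:
  assumes "n > 0" "admits_pgst n (quc_adj n)"
  obtains t :: "nat \<Rightarrow> real" and \<beta> where "even n" and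
    "\<And>j. (\<lambda>k. exp (- (\<i> * of_real (t k)) * circulant.lam n (quc_set n) (int j))) \<longlonglongrightarrow> \<beta> * (- 1) ^ j"
proof -
  interpret circulant n "quc_adj n" "quc_set n"
    using assms(1) by (rule circulant_quc)
  from assms(2) obtain a b where "a < n" "b < n" "a \<noteq> b" "pgst_between n (quc_adj n) a b"
    unfolding admits_pgst_def by metis
  then show ?thesis
    using that pgst_between_signs[of a b thesis] uminus_quc_set by blast
qed

lemma pgst_quc_odd_prime:
  assumes "n > 0" "admits_pgst n (quc_adj n)" "prime p" "odd p"
  shows "\<not> p dvd n"
proof
  assume "p dvd n"
  then obtain q where q: "n = q * p"
    by (metis dvd_def mult.commute)
  interpret circulant n "quc_adj n" "quc_set n"
    using assms(1) by (rule circulant_quc)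
  from assms(1,2) obtain t :: "nat \<Rightarrow> real" and \<beta> where "even n" and
    lim: "\<And>j. (\<lambda>k. exp (- (\<i> * of_real (t k)) * lam (int j))) \<longlonglongrightarrow> \<beta> * (- 1) ^ j"
    by (rule pgst_quc_signs) blast
  \<comment> \<open>An even step \<open>q\<close> makes the sign \<open>(- 1) ^ (j + i * q)\<close>
    constant along the coset, so the product below is a \<open>p\<close>-th power.\<close>
  then have "even q"
    using q \<open>odd p\<close> by simp
  have "\<not> int p dvd s" if "s \<in> quc_set n" for s
  proof
    assume "int p dvd s"
    then have "is_unit (int p)"
      using coprime_common_divisor[OF coprime_quc_set[OF that], of "int p"] \<open>p dvd n\<close> by simp
    then show False
      using \<open>prime p\<close> by (simp add: prime_nat_iff)
  qed
  then have sum0: "(\<Sum>i<p. lam (j + int i * int q)) = 0" for j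
    by (intro sum_lam_eq_0 q)
  have "(\<beta> * (- 1) ^ j) ^ p = 1" for j
  proof -
    have "(\<Prod>i<p. \<beta> * (- 1) ^ (j + i * q)) = 1"
    proof (rule prod_limit_eq_1)
      show "(\<lambda>k. exp (- (\<i> * of_real (t k)) * lam (int (j + i * q)))) \<longlonglongrightarrow> \<beta> * (- 1) ^ (j + i * q)" for i
        by (rule lim)
      show "(\<Sum>i<p. lam (int (j + i * q))) = 0"
        using sum0[of "int j"] by simp
    qed
    then show ?thesis
      using \<open>even q\<close> by (simp add: power_add)
  qed
  from this[of 0] this[of 1] show False
    using \<open>odd p\<close> by simp
qed

text \<open>The unit \<open>u\<close> is replaced by \<open>u + n / 4\<close>. Its square is
  \<open>u\<^sup>2 + (n / 2) * u + n * m\<close>, congruent to \<open>u\<^sup>2 + n / 2\<close>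
  because \<open>u\<close> is odd. The negated square also moves by \<open>n / 2\<close>, since
  \<open>n / 2\<close> and \<open>- n / 2\<close> agree modulo \<open>n\<close>.\<close>

lemma shift_quc_set:
  assumes "n = 16 * m" "s \<in> quc_set n"
  shows "(s + 8 * int m) mod int n \<in> quc_set n"
proof -
  from assms(2) obtain u where u: "coprime u (int n)" "[s = u\<^sup>2] (mod int n) \<or> [s = - (u\<^sup>2)] (mod int n)"
    and s: "0 < s" "s < int n"
    by (auto simp: quc_set_def)
  define v where "v = u + 4 * int m"
  have "odd u"
    using odd_if_coprime_even[OF u(1)] assms(1) by simp
  have "coprime u (4 * int m)"
    using u(1) assms(1) by (auto elim: coprime_divisors[rotated 2])
  then have "coprime v (4 * int m)"
    by (simp add: v_def coprime_iff_gcd_eq_1)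
  \<comment> \<open>The numbers \<open>4 * m\<close> and \<open>16 * m\<close> have the same prime
    divisors.\<close>
  then have "coprime v ((4 * int m) * 4)"
    by (simp only: coprime_mult_right_iff simp_thms)
  then have v: "coprime v (int n)"
    using assms(1) by (simp add: mult.commute)
  have v2: "v\<^sup>2 = u\<^sup>2 + 8 * int m * u + int n * int m"
    by (simp add: v_def power2_eq_square algebra_simps assms(1))
  from \<open>odd u\<close> obtain k where k: "u = 2 * k + 1"
    by (elim oddE)
  have "v\<^sup>2 = u\<^sup>2 + 8 * int m + int n * (k + int m)"
    unfolding v2 by (simp add: k algebra_simps assms(1))
  then have "[u\<^sup>2 + 8 * int m = v\<^sup>2] (mod int n)"
    by (simp add: cong_def)
  moreover have "- (v\<^sup>2) = - (u\<^sup>2) + 8 * int m + int n * (- k - int m - 1)"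
    unfolding v2 by (simp add: k algebra_simps assms(1))
  then have "[- (u\<^sup>2) + 8 * int m = - (v\<^sup>2)] (mod int n)"
    by (metis cong_def mod_mult_self2)
  ultimately have "[s + 8 * int m = v\<^sup>2] (mod int n) \<or> [s + 8 * int m = - (v\<^sup>2)] (mod int n)"
    using u(2) by (meson cong_add_rcancel cong_trans)
  moreover have "(s + 8 * int m) mod int n \<in> {1..<int n}"
  proof -
    \<comment> \<open>Parity excludes the residue 0: \<open>s + 8 * m\<close> is odd and
      \<open>n\<close> is even.\<close>
    have "odd s"
      using odd_if_coprime_even[OF coprime_quc_set[OF assms(2)]] assms(1) by simp
    then have "odd ((s + 8 * int m) mod int n)"
      using assms(1) by (simp add: dvd_mod_iff)
    then have "(s + 8 * int m) mod int n \<noteq> 0"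
      by auto
    moreover have "0 \<le> (s + 8 * int m) mod int n" "(s + 8 * int m) mod int n < int n"
      using s by simp_all
    ultimately show ?thesis
      by simp
  qed
  ultimately show ?thesis
    using v by (auto simp: quc_set_def cong_def)
qed

lemma pgst_quc_16:
  assumes "n > 0" "admits_pgst n (quc_adj n)"
  shows "\<not> 16 dvd n"
proof
  assume "16 dvd n"
  then obtain m where m: "n = 16 * m"
    by blast
  interpret circulant n "quc_adj n" "quc_set n"
    using assms(1) by (rule circulant_quc)
  from assms obtain t :: "nat \<Rightarrow> real" and \<beta> where
    lim: "\<And>j. (\<lambda>k. exp (- (\<i> * of_real (t k)) * lam (int j))) \<longlonglongrightarrow> \<beta> * (- 1) ^ j"
    by (rule pgst_quc_signs) blast
  have "chi n (8 * int m) \<noteq> 1"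
    using assms(1) m by (simp add: chi_eq_1_iff zdvd_not_zless)
  moreover have "chi n (8 * int m) * lam 1 = lam 1"
    using chi_mult_lam_shift[OF shift_quc_set[OF m], of 1] by simp
  ultimately have "lam 1 = 0"
    by simp
  \<comment> \<open>The exponentials at index 1 are constantly 1, while their limit is
    \<open>- \<beta>\<close>.\<close>
  then have \<beta>1: "\<beta> = - 1"
    using lim[of 1] by (simp add: LIMSEQ_const_iff minus_equation_iff)
  have "\<not> int 2 dvd s" if "s \<in> quc_set n" for s
    using odd_if_coprime_even[OF coprime_quc_set[OF that]] m by simp
  \<comment> \<open>The case \<open>d = 2\<close> gives
    \<open>lam (n / 4) + lam (3 * n / 4) = 0\<close>. The two indices are negatives of each other
    modulo \<open>n\<close>, so by symmetry both eigenvalues vanish.\<close>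
  then have "(\<Sum>i<2. lam (4 * int m + int i * int (8 * m))) = 0"
    using m by (intro sum_lam_eq_0) simp_all
  moreover have "lam (12 * int m) = lam (- (4 * int m))"
    by (rule lam_cong) (simp add: cong_iff_dvd_diff m)
  ultimately have "lam (int (4 * m)) = 0"
    using lam_uminus[OF uminus_quc_set] by (simp add: numeral_2_eq_2)
  then show False
    using lim[of "4 * m"] \<beta>1 by (simp add: LIMSEQ_const_iff)
qed

section \<open>Sufficiency: the graphs for 2, 4 and 8\<close>

text \<open>Odd squares are 1 modulo 8, as
  \<open>(2 * k + 1)\<^sup>2 - 1 = 4 * (k * (k + 1))\<close> and \<open>k * (k + 1)\<close> is even.
  The graph is therefore a single edge for \<open>n = 2\<close> and the cycle of length
  \<open>n\<close> for 4 and 8.\<close>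

lemma quc_set_dvd_8:
  assumes "n dvd 8" "even n"
  shows "quc_set n = {1, int n - 1}"
proof (intro equalityI subsetI)
  have n: "n \<ge> 2"
    using assms by (metis dvd_0_left_iff even_two_times_div_two dvd_imp_le gr0I numeral_eq_iff zero_neq_numeral)
  {
    fix s assume "s \<in> quc_set n"
    then obtain u where u: "coprime u (int n)" "[s = u\<^sup>2] (mod int n) \<or> [s = - (u\<^sup>2)] (mod int n)"
      and s: "1 \<le> s" "s < int n"
      by (auto simp: quc_set_def)
    have "odd u"
      using u(1) assms(2) by (rule odd_if_coprime_even)
    then obtain k where k: "u = 2 * k + 1"
      by (elim oddE)
    have "2 dvd k * (k + 1)"
      by simp
    then have "4 * 2 dvd 4 * (k * (k + 1))"
      by (rule mult_dvd_mono[OF dvd_refl])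
    also have "4 * (k * (k + 1)) = u\<^sup>2 - 1"
      by (simp add: k power2_eq_square algebra_simps)
    finally have "[u\<^sup>2 = 1] (mod 8)"
      by (simp add: cong_iff_dvd_diff)
    then have u2: "[u\<^sup>2 = 1] (mod int n)"
      using assms(1) by (metis cong_dvd_modulus int_dvd_int_iff of_nat_numeral)
    from u(2) have "[s = 1] (mod int n) \<or> [s = int n - 1] (mod int n)"
    proof
      assume "[s = u\<^sup>2] (mod int n)"
      then show ?thesis
        using u2 cong_trans by blast
    next
      assume "[s = - (u\<^sup>2)] (mod int n)"
      moreover have "[- (u\<^sup>2) = - 1] (mod int n)"
        using u2 by (simp add: cong_minus_minus_iff)
      moreover have "[- 1 = int n - 1] (mod int n)"
        by (simp add: cong_iff_dvd_diff)
      ultimately show ?thesis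
        using cong_trans by blast
    qed
    then show "s \<in> {1, int n - 1}"
      using s n cong_less_imp_eq_int[of s "int n" 1] cong_less_imp_eq_int[of s "int n" "int n - 1"]
      by auto
  }
  {
    fix s assume "s \<in> {1, int n - 1}"
    then show "s \<in> quc_set n"
      using n by (auto simp: quc_set_def cong_iff_dvd_diff intro!: exI[of _ 1])
  }
qed

lemma chi_half:
  assumes "m > 0"
  shows "chi (2 * m) (int j * int m) = (- 1) ^ j"
  using assms by (simp add: chi_mult_of_nat) (simp add: chi_def)

lemma lam_quc_dvd_8:
  assumes "n dvd 8" "n > 2" "even n"
  shows "circulant.lam n (quc_set n) (int j) = of_real (2 * cos (2 * pi * real j / real n))"
proof -
  interpret circulant n "quc_adj n" "quc_set n"
    using assms by (intro circulant_quc) simp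
  \<comment> \<open>For \<open>n > 2\<close> the residues 1 and \<open>n - 1\<close> are distinct,
    so the sum has two terms.\<close>
  have "lam (int j) = chi n (int j) + chi n (int j * (int n - 1))"
    using assms(2) unfolding lam_def unfolding quc_set_dvd_8[OF assms(1,3)] by simp
  also have "chi n (int j * (int n - 1)) = chi n (- int j)"
    by (rule chi_cong) (simp add: cong_iff_dvd_diff algebra_simps)
  also have "chi n (int j) + chi n (- int j) = of_real (2 * cos (2 * pi * real j / real n))"
    by (simp add: chi_def complex_eq_iff)
  finally show ?thesis .
qed

lemma exp_eq_cis: "exp (- (\<i> * complex_of_real t) * of_real x) = cis (- (t * x))"
  by (simp add: cis_conv_exp mult.assoc)

text \<open>The eigenvalues are 1 and -1, and at time \<open>pi / 2\<close> the eigenvalue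
  \<open>x\<close> gives the phase \<open>- \<i> * x\<close>. The transfer is exact, so a constant
  sequence of times works.\<close>

lemma admits_pgst_quc_2: "admits_pgst 2 (quc_adj 2)"
proof -
  interpret circulant 2 "quc_adj 2" "quc_set 2"
    by (rule circulant_quc) simp
  have lam: "lam (int j) = of_real ((- 1) ^ j)" for j
    using chi_half[of 1 j] unfolding lam_def by (simp add: quc_set_dvd_8)
  have "pgst_between 2 (quc_adj 2) 0 1"
  proof (rule pgst_betweenI[where t = "\<lambda>_. pi / 2" and \<beta> = "- \<i>"])
    fix j :: nat assume "j < 2"
    then have "j = 0 \<or> j = 1"
      by linarith
    then have "cis (- (pi / 2 * (- 1) ^ j)) = - \<i> * (- 1) ^ j"
      by (auto simp: complex_eq_iff)
    then show "(\<lambda>_. exp (- (\<i> * of_real (pi / 2)) * lam (int j))) \<longlonglongrightarrow>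
        - \<i> * chi 2 (int j * (int 1 - int 0))"
      using chi_half[of 1 j] unfolding lam exp_eq_cis by simp
  qed simp_all
  then show ?thesis
    unfolding admits_pgst_def by (intro exI[of _ 0] exI[of _ 1] conjI) simp_all
qed

text \<open>The eigenvalues 2, 0, -2, 0 give the phases -1, 1, -1, 1 at time \<open>pi / 2\<close>,
  which is again exact transfer, to the antipodal vertex.\<close>

lemma admits_pgst_quc_4: "admits_pgst 4 (quc_adj 4)"
proof -
  interpret circulant 4 "quc_adj 4" "quc_set 4"
    by (rule circulant_quc) simp
  have lam: "lam (int j) = of_real (2 * cos (pi * real j / 2))" for j
    using lam_quc_dvd_8[of 4 j] by simp
  have "pgst_between 4 (quc_adj 4) 0 2"
  proof (rule pgst_betweenI[where t = "\<lambda>_. pi / 2" and \<beta> = "- 1"])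
    fix j :: nat assume "j < 4"
    then have "j = 0 \<or> j = 1 \<or> j = 2 \<or> j = 3"
      by linarith
    moreover have "cos (pi * 3 / 2) = 0"
      using cos_3over2_pi by (simp add: mult.commute)
    ultimately have "cis (- (pi / 2 * (2 * cos (pi * real j / 2)))) = - ((- 1) ^ j)"
      by (auto simp: complex_eq_iff)
    then show "(\<lambda>_. exp (- (\<i> * of_real (pi / 2)) * lam (int j))) \<longlonglongrightarrow>
        - 1 * chi 4 (int j * (int 2 - int 0))"
      using chi_half[of 2 j] unfolding lam exp_eq_cis by simp
  qed simp_all
  then show ?thesis
    unfolding admits_pgst_def by (intro exI[of _ 0] exI[of _ 2] conjI) simp_all
qed

text \<open>Multiplication by \<open>1 - sqrt 2\<close> sends the coordinates \<open>(x, y)\<close>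
  to \<open>(x + 2 * y, x + y)\<close>, which preserves the parity of \<open>x\<close>.\<close>

lemma power_one_minus_sqrt_2:
  "\<exists>x y :: int. odd x \<and> (1 - sqrt 2) ^ k = of_int x - of_int y * sqrt 2"
proof (induction k)
  case 0
  show ?case
    by (intro exI[of _ 1] exI[of _ 0]) simp
next
  case (Suc k)
  then obtain x y :: int where xy: "odd x" "(1 - sqrt 2) ^ k = of_int x - of_int y * sqrt 2"
    by blast
  have "(1 - sqrt 2) ^ Suc k = (of_int x - of_int y * sqrt 2) * (1 - sqrt 2)"
    by (simp add: xy(2))
  also have "\<dots> = of_int (x + 2 * y) - of_int (x + y) * sqrt 2"
    by (simp add: algebra_simps)
  finally have "(1 - sqrt 2) ^ Suc k = of_int (x + 2 * y) - of_int (x + y) * sqrt 2" .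
  moreover have "odd (x + 2 * y)"
    using xy by simp
  ultimately show ?case
    by blast
qed

lemma cis_pi_times_int: "cis (pi * of_int x) = (if even x then 1 else - 1)"
  by (simp add: complex_eq_iff cos_int_times_real mult.commute)

text \<open>
  The nonzero eigenvalues of the 8-cycle are \<open>\<plusminus>2\<close> at even and \<open>\<plusminus>sqrt 2\<close> at odd indices, so transfer
  happens at \<open>t = pi * y\<close> when \<open>y * sqrt 2\<close> is close to an odd integer \<open>x\<close>.  Pairs with this property
  are the coordinates of the powers of \<open>1 - sqrt 2\<close>.
\<close>

lemma admits_pgst_quc_8: "admits_pgst 8 (quc_adj 8)"
proof -
  interpret circulant 8 "quc_adj 8" "quc_set 8"
    by (rule circulant_quc) simp
  obtain x y :: "nat \<Rightarrow> int" where odd: "\<And>k. odd (x k)"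
    and xy: "\<And>k. (1 - sqrt 2) ^ k = of_int (x k) - of_int (y k) * sqrt 2"
    using power_one_minus_sqrt_2 by metis
  define d where "d k = (1 - sqrt 2) ^ k" for k
  have "\<bar>1 - sqrt 2\<bar> < 1"
    using sqrt2_less_2 by simp
  then have "d \<longlonglongrightarrow> 0"
    unfolding d_def by (intro LIMSEQ_abs_realpow_zero2)
  have lim: "(\<lambda>k. cis (- (pi * of_int (y k) * (of_int s * sqrt 2)))) \<longlonglongrightarrow> - 1" if "odd s" for s :: int
  proof -
    have "(\<lambda>k. - cis (of_int s * (pi * d k))) \<longlonglongrightarrow> - cis (of_int s * (pi * 0))"
      by (intro tendsto_intros \<open>d \<longlonglongrightarrow> 0\<close>)
    moreover have "cis (- (pi * of_int (y k) * (of_int s * sqrt 2))) = - cis (of_int s * (pi * d k))" for k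
    proof -
      \<comment> \<open>Substitution of \<open>y k * sqrt 2 = x k - d k\<close>: the odd multiple
        \<open>s * x k\<close> of \<open>pi\<close> contributes the sign, and the remaining angle
        tends to 0.\<close>
      have "- (pi * of_int (y k) * (of_int s * sqrt 2)) = of_int s * (pi * d k) + pi * of_int (- (s * x k))"
        by (simp add: d_def xy algebra_simps)
      then show ?thesis
        using that odd[of k] by (simp only: cis_mult[symmetric] cis_pi_times_int) simp
    qed
    ultimately show ?thesis
      by simp
  qed
  have "pgst_between 8 (quc_adj 8) 0 4"
  proof (rule pgst_betweenI[where t = "\<lambda>k. pi * of_int (y k)" and \<beta> = 1])
    fix j :: nat assume "j < 8"
    have lam: "lam (int j) = of_real (2 * cos (pi * real j / 4))"
      using lam_quc_dvd_8[of 8 j] by simp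
    show "(\<lambda>k. exp (- (\<i> * of_real (pi * of_int (y k))) * lam (int j))) \<longlonglongrightarrow>
        1 * chi 8 (int j * (int 4 - int 0))"
    proof (cases "even j")
      case True
      then have "j = 0 \<or> j = 2 \<or> j = 4 \<or> j = 6"
        using \<open>j < 8\<close> by presburger
      then have "\<exists>e :: int. cos (pi * real j / 4) = of_int e"
        using cos_3over2_pi by (auto simp: mult.commute intro: exI[of _ 0] exI[of _ 1] exI[of _ "- 1"])
      then obtain e :: int where "cos (pi * real j / 4) = of_int e"
        by blast
      \<comment> \<open>At even \<open>j\<close> the eigenvalue is the even integer
        \<open>2 * e\<close>, so the angle is a multiple of \<open>2 * pi\<close> and the phase is
        exactly 1 at every time.\<close>
      then have "cis (- (pi * of_int (y k) * (2 * cos (pi * real j / 4)))) = cis (pi * of_int (- (2 * y k * e)))" for k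
        by (simp add: mult_ac)
      then show ?thesis
        using True chi_half[of 4 j] unfolding lam exp_eq_cis cis_pi_times_int by simp
    next
      case False
      then have "j = 1 \<or> j = 3 \<or> j = 5 \<or> j = 7"
        using \<open>j < 8\<close> by presburger
      moreover have "cos (pi * 3 / 4) = - (sqrt 2 / 2)"
        using cos_pi_minus[of "pi / 4"] by (simp add: cos_45 field_simps)
      moreover have "cos (pi * 5 / 4) = - (sqrt 2 / 2)"
        using cos_periodic_pi[of "pi / 4"] by (simp add: cos_45 field_simps)
      moreover have "cos (pi * 7 / 4) = sqrt 2 / 2"
        using cos_2pi_minus[of "pi / 4"] by (simp add: cos_45 field_simps)
      ultimately have "2 * cos (pi * real j / 4) = of_int 1 * sqrt 2 \<or>
          2 * cos (pi * real j / 4) = of_int (- 1) * sqrt 2"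
        by (auto simp: cos_45)
      then obtain s :: int where "odd s" "2 * cos (pi * real j / 4) = of_int s * sqrt 2"
        by (metis odd_one even_minus)
      then show ?thesis
        using False chi_half[of 4 j] lim[of s] unfolding lam exp_eq_cis by simp
    qed
  qed simp_all
  then show ?thesis
    unfolding admits_pgst_def by (intro exI[of _ 0] exI[of _ 4] conjI) simp_all
qed

theorem theorem5p6:
  fixes n :: nat
  assumes "n > 0"
  shows "admits_pgst n (quc_adj n) \<longleftrightarrow> n \<in> {2, 4, 8}"
proof
  assume pgst: "admits_pgst n (quc_adj n)"
  define k where "k = multiplicity 2 n"
  obtain m where m: "n = 2 ^ k * m" "\<not> 2 dvd m"
    using multiplicity_decompose'[of n 2] assms unfolding k_def by auto
  have "m = 1"
  proof (rule ccontr)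
    assume "m \<noteq> 1"
    \<comment> \<open>Such a \<open>p\<close> is odd because \<open>m\<close> is odd.\<close>
    then obtain p where "prime p" "p dvd m"
      by (metis prime_factor_nat)
    then show False
      using pgst_quc_odd_prime[OF assms pgst] m by (metis dvd_mult dvd_trans)
  qed
  \<comment> \<open>This excludes \<open>k = 0\<close>, that is, \<open>n = 1\<close>.\<close>
  moreover have "even n"
    using assms pgst by (rule pgst_quc_signs)
  moreover have "k < 4"
  proof (rule ccontr)
    assume "\<not> k < 4"
    then have "(2 :: nat) ^ 4 dvd 2 ^ k"
      by (intro le_imp_power_dvd) simp
    then show False
      using pgst_quc_16[OF assms pgst] m by simp
  qed
  then have "k = 0 \<or> k = 1 \<or> k = 2 \<or> k = 3"
    by linarith
  ultimately show "n \<in> {2, 4, 8}"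
    using m by auto
next
  assume "n \<in> {2, 4, 8}"
  then show "admits_pgst n (quc_adj n)"
    using admits_pgst_quc_2 admits_pgst_quc_4 admits_pgst_quc_8 by auto
qed

end
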